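(* Let $d = p_1p_2\cdots p_m \ge 2$ be a positive square-free integer, where the $p_j$ are distinct primes. Let $N\ge 2$ be an integer and let $A$ be an $n\times n$ matrix with non-negative integer entries such that $A^N = dI_n$. Then $n=tN$ for some integer $t\ge 1$, and there exists a permutation matrix $P=E(i_1,j_1)E(i_2,j_2)\cdots E(i_s,j_s)$ such that $$PAP^{-1}=\begin{bmatrix} A_1 & & & \\ & A_2 & & \\ & & \ddots & \\ & & & A_t\end{bmatrix}$$ is block diagonal, where for each $1\le k\le t$ the block $A_k$ is the $N\times N$ matrix $$A_k=\begin{bmatrix} 0 & \cdots & 0 & c_{Nk}\\ c_{1k} & \cdots & 0 & 0\\ \vdots & \ddots & \vdots & \vdots\\ 0 & \cdots & c_{(N-1)k} & 0\end{bmatrix},$$ that is, the $(i+1,i)$-entry of $A_k$ is $c_{ik}$ for $1\le i\le N-1$, the $(1,N)$-entry is $c_{Nk}$, and all other entries are $0$. Here the $c_{ik}$ ($1\le i\le N$) are positive integers satisfying $c_{1k}c_{2k}\cdots c_{Nk}=d$.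
   Context: $I_n$ is the $n\times n$ identity matrix. For $1\le i\ne j\le n$, $E(i,j)$ denotes the elementary matrix obtained from $I_n$ by interchanging the $i$-th and $j$-th rows. The product of the $E(i_l,j_l)$ may be empty, in which case it equals $I_n$. *)

theory Defs
  imports
    "HOL-Computational_Algebra.Squarefree"
    "Jordan_Normal_Form.Gauss_Jordan_Elimination"
begin

text \<open>Rows and columns of matrices are numbered from 0, so the elementary matrix
  \<open>E(i,j)\<close> with 1-based indices is \<open>elem_swap n (i - 1) (j - 1)\<close>.\<close>

definition elem_swap :: "nat \<Rightarrow> nat \<Rightarrow> nat \<Rightarrow> int mat" where
  "elem_swap n i j = swaprows i j (1\<^sub>m n)"

definition swap_prod :: "nat \<Rightarrow> (nat \<times> nat) list \<Rightarrow> int mat" where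
  "swap_prod n ijs = foldr (\<lambda>(i, j) M. elem_swap n i j * M) ijs (1\<^sub>m n)"

text \<open>The values \<open>c 1, \<dots>, c N\<close> are numbered from 1: the 1-based entry \<open>(i + 1, i)\<close>,
  whose value is \<open>c i\<close>, is the 0-based entry \<open>(i, i - 1)\<close>.\<close>

definition cyclic_block :: "nat \<Rightarrow> (nat \<Rightarrow> int) \<Rightarrow> int mat" where
  "cyclic_block N c = mat N N (\<lambda>(r, s).
     if r = s + 1 then c r else if r = 0 \<and> s = N - 1 then c N else 0)"

end

theory Submission
  imports Defs "HOL-Combinatorics.Permutations"
begin

text \<open>Write \<open>B = A\<^sup>N\<^sup>-\<^sup>1\<close>. Since \<open>A\<close> and \<open>B\<close> are non-negative, no cancellation can occur in
  \<open>A B = B A = d I\<close>, and this forces every row of \<open>A\<close> to have exactly one non-zero entry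
  (\<open>nonneg_factor_of_scalar_row\<close>): row \<open>i\<close> carries a weight \<open>a i > 0\<close> in column \<open>f i\<close>. So \<open>A\<close> is a
  weighted functional graph, and row \<open>i\<close> of \<open>A\<^sup>k\<close> carries the weight
  \<open>a i \<cdot> a (f i) \<cdots> a (f\<^sup>k\<^sup>-\<^sup>1 i)\<close> in column \<open>f\<^sup>k i\<close> (\<open>monomial_pow_index\<close>).

  Comparing \<open>A\<^sup>N\<close> with \<open>d I\<close> gives \<open>f\<^sup>N i = i\<close>, and the product of the weights along \<open>N\<close> steps is \<open>d\<close>.
  If the cycle of \<open>i\<close> had a length \<open>l < N\<close>, then \<open>l\<close> would divide \<open>N\<close> and \<open>d\<close> would be the
  \<open>N / l\<close>-th power of the weight product around the cycle, which is impossible for a square-free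
  \<open>d \<ge> 2\<close> (\<open>squarefree_walk_product_no_short_cycle\<close>). Hence the indices split into \<open>t\<close> cycles of length
  exactly \<open>N\<close>, so \<open>n = t N\<close>. Listing the cycles one after the other, each of them backwards along \<open>f\<close>
  (\<open>orbit_listing\<close>), is a permutation of the indices that turns \<open>A\<close> into the desired block
  diagonal form (\<open>mat_concat_blocks\<close>, \<open>orbit_block\<close>); as every permutation is a product of
  transpositions, it is realised by a product of the matrices \<open>E(i,j)\<close> (\<open>perm_matrix_swap_prod\<close>).\<close>

section \<open>Non-negative factors of a scalar matrix are monomial\<close>

text \<open>Some \<open>j\<close> satisfies \<open>A\<^sub>i\<^sub>j B\<^sub>j\<^sub>i > 0\<close>, because the diagonal entry \<open>(i, i)\<close> of \<open>A B\<close> is \<open>d\<close>. A non-zero entry of row \<open>i\<close> of \<open>A\<close> in a further column \<open>k\<close> would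
  make the off-diagonal entry \<open>(j, k)\<close> of \<open>B A\<close> at least \<open>B\<^sub>j\<^sub>i A\<^sub>i\<^sub>k > 0\<close>.\<close>

lemma nonneg_factor_of_scalar_row:
  fixes A B :: "'a::linordered_idom mat"
  assumes A: "A \<in> carrier_mat n n" and B: "B \<in> carrier_mat n n"
    and A0: "\<And>i j. i < n \<Longrightarrow> j < n \<Longrightarrow> A $$ (i, j) \<ge> 0"
    and B0: "\<And>i j. i < n \<Longrightarrow> j < n \<Longrightarrow> B $$ (i, j) \<ge> 0"
    and AB: "A * B = d \<cdot>\<^sub>m 1\<^sub>m n" and BA: "B * A = d \<cdot>\<^sub>m 1\<^sub>m n"
    and d: "d \<noteq> 0" and i: "i < n"
  shows "\<exists>j<n. A $$ (i, j) > 0 \<and> (\<forall>k<n. k \<noteq> j \<longrightarrow> A $$ (i, k) = 0)"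
proof -
  have "(\<Sum>j\<in>{0..<n}. A $$ (i, j) * B $$ (j, i)) = (A * B) $$ (i, i)"
    using A B i by (simp add: scalar_prod_def)
  also have "\<dots> \<noteq> 0"
    using AB i d by simp
  finally obtain j where j: "j < n" and prod: "A $$ (i, j) * B $$ (j, i) \<noteq> 0"
    by (metis (no_types, lifting) atLeastLessThan_iff sum.neutral)
  have Aij: "A $$ (i, j) > 0" and Bji: "B $$ (j, i) > 0"
    using prod A0[OF i j] B0[OF j i] by auto
  have "A $$ (i, k) = 0" if k: "k < n" and kj: "k \<noteq> j" for k
  proof -
    have "(\<Sum>l\<in>{0..<n}. B $$ (j, l) * A $$ (l, k)) = (B * A) $$ (j, k)"
      using A B j k by (simp add: scalar_prod_def)
    also have "\<dots> = 0"
      using BA j k kj by simp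
    finally have "\<forall>l\<in>{0..<n}. B $$ (j, l) * A $$ (l, k) = 0"
      by (subst (asm) sum_nonneg_eq_0_iff) (use A0 B0 j k in auto)
    with i have "B $$ (j, i) * A $$ (i, k) = 0"
      by simp
    with Bji show ?thesis
      by simp
  qed
  with j Aij show ?thesis
    by blast
qed

lemma pow_mat_comm:
  fixes A :: "'a::semiring_1 mat"
  assumes A: "A \<in> carrier_mat n n"
  shows "A * A ^\<^sub>m k = A ^\<^sub>m k * A"
proof (induction k)
  case 0
  show ?case
    using A by simp
next
  case (Suc k)
  have "A * (A ^\<^sub>m k * A) = (A * A ^\<^sub>m k) * A"
    by (rule assoc_mult_mat[symmetric, of _ n n _ n _ n]) (use A in auto)
  with Suc show ?case
    by simp
qed

lemma pow_mat_nonneg: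
  fixes A :: "'a::linordered_idom mat"
  assumes A: "A \<in> carrier_mat n n"
    and A0: "\<And>i j. i < n \<Longrightarrow> j < n \<Longrightarrow> A $$ (i, j) \<ge> 0"
  shows "i < n \<Longrightarrow> j < n \<Longrightarrow> (A ^\<^sub>m k) $$ (i, j) \<ge> 0"
proof (induction k arbitrary: i j)
  case 0
  then show ?case
    using A by simp
next
  case (Suc k)
  have "A ^\<^sub>m k \<in> carrier_mat n n"
    using A by simp
  then have "(A ^\<^sub>m Suc k) $$ (i, j) = (\<Sum>l\<in>{0..<n}. (A ^\<^sub>m k) $$ (i, l) * A $$ (l, j))"
    using A Suc.prems by (simp add: scalar_prod_def)
  also have "\<dots> \<ge> 0"
    by (rule sum_nonneg) (use Suc A0 in auto)
  finally show ?case .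
qed

text \<open>A monomial matrix moves along the functional graph of \<open>f\<close>: the power \<open>A\<^sup>k\<close> records the end point
  and the weight product of the walk of length \<open>k\<close> starting at \<open>i\<close>.\<close>

lemma monomial_pow_index:
  fixes A :: "'a::comm_semiring_1 mat"
  assumes A: "A \<in> carrier_mat n n"
    and f: "\<And>i. i < n \<Longrightarrow> f i < n"
    and Af: "\<And>i j. i < n \<Longrightarrow> j < n \<Longrightarrow> A $$ (i, j) = (if j = f i then a i else 0)"
    and i: "i < n"
  shows "j < n \<Longrightarrow>
    (A ^\<^sub>m k) $$ (i, j) = (if j = (f ^^ k) i then (\<Prod>l<k. a ((f ^^ l) i)) else 0)"
proof (induction k arbitrary: j)
  case 0
  then show ?case
    using A i by auto
next
  case (Suc k)
  have fk: "(f ^^ k) i < n"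
    by (induction k) (use i f in auto)
  have "A ^\<^sub>m k \<in> carrier_mat n n"
    using A by simp
  then have "(A ^\<^sub>m Suc k) $$ (i, j) = (\<Sum>l\<in>{0..<n}. (A ^\<^sub>m k) $$ (i, l) * A $$ (l, j))"
    using A Suc.prems i by (simp add: scalar_prod_def)
  also have "\<dots> = (\<Sum>l\<in>{0..<n}. if l = (f ^^ k) i
      then (\<Prod>l<k. a ((f ^^ l) i)) * A $$ ((f ^^ k) i, j) else 0)"
    by (rule sum.cong) (use Suc.IH in auto)
  also have "\<dots> = (\<Prod>l<k. a ((f ^^ l) i)) * A $$ ((f ^^ k) i, j)"
    using fk by simp
  also have "\<dots> = (if j = (f ^^ Suc k) i then (\<Prod>l<Suc k. a ((f ^^ l) i)) else 0)"
    using Af[OF fk Suc.prems] by simp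
  finally show ?case .
qed

section \<open>Square-freeness excludes short cycles\<close>

text \<open>A walk of length \<open>k q\<close> along a cycle that closes after \<open>k\<close> steps runs \<open>q\<close> times through the same
  weights.\<close>

lemma walk_product_periodic:
  fixes a :: "'b \<Rightarrow> 'a::comm_monoid_mult"
  assumes "(f ^^ k) x = x"
  shows "(\<Prod>l<k * q. a ((f ^^ l) x)) = (\<Prod>l<k. a ((f ^^ l) x)) ^ q"
proof (induction q)
  case 0
  show ?case
    by simp
next
  case (Suc q)
  have period: "(f ^^ (l + k * q)) x = (f ^^ l) x" for l
    using funpow_mod_eq[OF assms, of "l + k * q"] funpow_mod_eq[OF assms, of l] by simp
  have "(\<Prod>l<k * Suc q. a ((f ^^ l) x)) =
      (\<Prod>l<k * q. a ((f ^^ l) x)) * (\<Prod>l=k * q..<k * q + k. a ((f ^^ l) x))"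
    by (metis add.commute le_add1 lessThan_atLeast0 mult_Suc_right prod.atLeastLessThan_concat zero_le)
  also have "(\<Prod>l=k * q..<k * q + k. a ((f ^^ l) x)) = (\<Prod>l<k. a ((f ^^ l) x))"
    using prod.shift_bounds_nat_ivl[of "\<lambda>l. a ((f ^^ l) x)" 0 "k * q" k]
    by (simp add: period lessThan_atLeast0 add.commute)
  finally show ?case
    using Suc by (simp add: mult.commute)
qed

text \<open>A return time \<open>k < N\<close> may be taken minimal; then it divides \<open>N\<close>, and the walk product over \<open>N\<close> steps
  is a proper power.\<close>

lemma squarefree_walk_product_no_short_cycle:
  fixes a :: "'b \<Rightarrow> 'a::algebraic_semidom"
  assumes sf: "squarefree (\<Prod>l<N. a ((f ^^ l) x))"
    and nonunit: "\<not> is_unit (\<Prod>l<N. a ((f ^^ l) x))"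
    and N: "(f ^^ N) x = x" and k: "0 < k" "k < N"
  shows "(f ^^ k) x \<noteq> x"
proof
  assume "(f ^^ k) x = x"
  define m where "m = (LEAST m. 0 < m \<and> (f ^^ m) x = x)"
  have m: "0 < m" "(f ^^ m) x = x" and "m \<le> k"
    using LeastI[of "\<lambda>m. 0 < m \<and> (f ^^ m) x = x" k] k \<open>(f ^^ k) x = x\<close>
      Least_le[of "\<lambda>m. 0 < m \<and> (f ^^ m) x = x" k]
    unfolding m_def by auto
  have "(f ^^ (N mod m)) x = x"
    using funpow_mod_eq[OF m(2)] N by simp
  with m(1) have "N mod m = 0"
    using not_less_Least[of "N mod m" "\<lambda>m. 0 < m \<and> (f ^^ m) x = x"]
    unfolding m_def[symmetric] by auto
  then obtain q where q: "N = m * q"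
    by auto
  have "q \<noteq> 0"
    using q k by (intro notI) simp
  moreover have "q \<noteq> 1"
    using q k \<open>m \<le> k\<close> by (intro notI) simp
  ultimately have "q \<ge> 2"
    by simp
  have prod: "(\<Prod>l<N. a ((f ^^ l) x)) = (\<Prod>l<m. a ((f ^^ l) x)) ^ q"
    unfolding q by (rule walk_product_periodic[OF m(2)])
  with \<open>q \<ge> 2\<close> have "(\<Prod>l<m. a ((f ^^ l) x)) ^ 2 dvd (\<Prod>l<N. a ((f ^^ l) x))"
    by (simp add: le_imp_power_dvd)
  with sf have "is_unit (\<Prod>l<m. a ((f ^^ l) x))"
    by (auto simp: squarefree_def)
  with nonunit prod show False
    by (metis dvd_power_same power_one)
qed

section \<open>Listing the indices cycle by cycle\<close>

text \<open>The cycle is listed against the direction of \<open>f\<close>, because the cyclic block has its non-zero entries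
  in the positions \<open>(r, r - 1)\<close>: the map \<open>f\<close> has to decrease positions by one. The exponent \<open>N - r\<close>
  stands for \<open>- r\<close> and avoids the inverse of \<open>f\<close>.\<close>

definition orbit_list :: "('b \<Rightarrow> 'b) \<Rightarrow> nat \<Rightarrow> 'b \<Rightarrow> 'b list" where
  "orbit_list f N x = map (\<lambda>r. (f ^^ (N - r)) x) [0..<N]"

lemma length_orbit_list [simp]: "length (orbit_list f N x) = N"
  by (simp add: orbit_list_def)

lemma nth_orbit_list [simp]: "r < N \<Longrightarrow> orbit_list f N x ! r = (f ^^ (N - r)) x"
  by (simp add: orbit_list_def)

lemma orbit_list_step:
  assumes "(f ^^ N) x = x" and "r < N"
  shows "f (orbit_list f N x ! r) = orbit_list f N x ! (if r = 0 then N - 1 else r - 1)"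
proof (cases "r = 0")
  case True
  with assms show ?thesis
    by simp
next
  case False
  with assms have "N - (r - 1) = Suc (N - r)"
    by simp
  with False assms show ?thesis
    by simp
qed

lemma funpow_in_orbit_list:
  assumes N: "(f ^^ N) x = x" "0 < N"
  shows "(f ^^ k) x \<in> set (orbit_list f N x)"
proof -
  have "(f ^^ k) x = (f ^^ (k mod N)) x"
    using funpow_mod_eq[OF N(1)] by simp
  \<comment> \<open>Position \<open>0\<close> holds \<open>f\<^sup>N x = x\<close>, so the remainder \<open>0\<close> is found there and not at position \<open>N\<close>.\<close>
  moreover have "\<dots> = orbit_list f N x ! (if k mod N = 0 then 0 else N - k mod N)"
    using N by auto
  moreover have "(if k mod N = 0 then 0 else N - k mod N) < N"
    using N by auto
  ultimately show ?thesis
    by (metis length_orbit_list nth_mem)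
qed

lemma orbit_list_elem:
  assumes "y \<in> set (orbit_list f N x)"
  obtains k where "y = (f ^^ k) x"
  using assms by (auto simp: orbit_list_def)

lemma distinct_orbit_list:
  assumes N: "(f ^^ N) x = x"
    and short: "\<And>k. 0 < k \<Longrightarrow> k < N \<Longrightarrow> (f ^^ k) x \<noteq> x"
  shows "distinct (orbit_list f N x)"
proof -
  have "(f ^^ (N - r)) x \<noteq> (f ^^ (N - s)) x" if rs: "r < s" "s < N" for r s
  proof
    assume "(f ^^ (N - r)) x = (f ^^ (N - s)) x"
    then have "(f ^^ (s + (N - r))) x = (f ^^ (s + (N - s))) x"
      by (simp only: funpow_add o_apply)
    moreover have "s + (N - r) = (s - r) + N" "s + (N - s) = N"
      using rs by auto
    ultimately have "(f ^^ (s - r)) x = x"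
      using N by (simp add: funpow_add)
    moreover have "(f ^^ (s - r)) x \<noteq> x"
      by (rule short) (use rs in linarith)+
    ultimately show False
      by simp
  qed
  then show ?thesis
    by (auto simp: distinct_conv_nth) (metis nat_neq_iff)
qed

text \<open>Induction on the size of \<open>S\<close>: the complement of one orbit is again closed under \<open>f\<close>, because \<open>f\<close>
  has the inverse \<open>f\<^sup>N\<^sup>-\<^sup>1\<close> on \<open>S\<close>.\<close>

lemma orbit_listing:
  assumes "finite S" and N: "0 < N"
    and "\<And>x. x \<in> S \<Longrightarrow> f x \<in> S"
    and "\<And>x. x \<in> S \<Longrightarrow> (f ^^ N) x = x"
    and "\<And>x k. x \<in> S \<Longrightarrow> 0 < k \<Longrightarrow> k < N \<Longrightarrow> (f ^^ k) x \<noteq> x"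
  shows "\<exists>xs. set xs \<subseteq> S \<and> distinct (concat (map (orbit_list f N) xs)) \<and>
    set (concat (map (orbit_list f N) xs)) = S"
  using assms(1,3-)
proof (induction S rule: finite_psubset_induct)
  case (psubset S)
  show ?case
  proof (cases "S = {}")
    case True
    then show ?thesis
      by (intro exI[of _ "[]"]) simp
  next
    case False
    then obtain x where x: "x \<in> S"
      by blast
    let ?O = "set (orbit_list f N x)"
    have OS: "?O \<subseteq> S"
    proof
      fix y assume "y \<in> ?O"
      then obtain k where "y = (f ^^ k) x"
        by (rule orbit_list_elem)
      moreover have "(f ^^ k) x \<in> S"
        by (induction k) (use x psubset.prems(1) in auto)
      ultimately show "y \<in> S"
        by simp
    qed
    have "x \<in> ?O"
      using funpow_in_orbit_list[OF psubset.prems(2)[OF x] N, of 0] by simp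
    with x have sub: "S - ?O \<subset> S"
      by blast
    have closed: "f y \<in> S - ?O" if y: "y \<in> S - ?O" for y
    proof -
      have "y \<in> ?O" if "f y \<in> ?O"
      proof -
        from \<open>f y \<in> ?O\<close> obtain k where k: "f y = (f ^^ k) x"
          by (rule orbit_list_elem)
        have "y = (f ^^ Suc (N - 1)) y"
          using y psubset.prems(2) N by simp
        also have "\<dots> = (f ^^ (N - 1)) (f y)"
          by (simp only: funpow_Suc_right o_apply)
        also have "\<dots> = (f ^^ (N - 1 + k)) x"
          by (simp add: k funpow_add)
        finally show ?thesis
          using funpow_in_orbit_list[OF psubset.prems(2)[OF x] N] by simp
      qed
      with y psubset.prems(1) show ?thesis
        by blast
    qed
    have "\<exists>xs. set xs \<subseteq> S - ?O \<and> distinct (concat (map (orbit_list f N) xs)) \<and>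
        set (concat (map (orbit_list f N) xs)) = S - ?O"
      by (rule psubset.IH[OF sub]) (use closed psubset.prems in auto)
    then obtain xs where xs: "set xs \<subseteq> S - ?O" "distinct (concat (map (orbit_list f N) xs))"
      "set (concat (map (orbit_list f N) xs)) = S - ?O"
      by blast
    have "distinct (orbit_list f N x)"
      by (rule distinct_orbit_list) (use x psubset.prems in auto)
    with xs OS x show ?thesis
      by (intro exI[of _ "x # xs"]) auto
  qed
qed

section \<open>Block diagonal form\<close>

lemma distinct_concat_disjoint:
  "distinct (concat bs) \<Longrightarrow> sorted_wrt (\<lambda>b c. set b \<inter> set c = {}) bs"
  by (induction bs) auto

text \<open>A table \<open>B\<close> whose entries between different blocks of labels vanish becomes block diagonal once the
  labels are listed block by block. Ordering the pairs of blocks by \<open>sorted_wrt\<close> lets the proof peel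
  off the first block, just as the recursion of \<open>diag_block_mat\<close> does.\<close>

lemma mat_concat_blocks:
  fixes B :: "'b \<Rightarrow> 'b \<Rightarrow> 'a::zero"
  assumes "sorted_wrt (\<lambda>b c. \<forall>u\<in>set b. \<forall>v\<in>set c. B u v = 0 \<and> B v u = 0) bs"
  shows "mat (length (concat bs)) (length (concat bs)) (\<lambda>(i, j). B (concat bs ! i) (concat bs ! j)) =
    diag_block_mat (map (\<lambda>b. mat (length b) (length b) (\<lambda>(i, j). B (b ! i) (b ! j))) bs)"
  using assms
proof (induction bs)
  case Nil
  show ?case
    by auto
next
  case (Cons b bs)
  let ?M = "\<lambda>b. mat (length b) (length b) (\<lambda>(i, j). B (b ! i) (b ! j))"
  let ?D = "diag_block_mat (map ?M bs)"
  have D: "?D = ?M (concat bs)"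
    using Cons by simp
  have z: "B u v = 0" "B v u = 0" if "u \<in> set b" "v \<in> set (concat bs)" for u v
    using Cons.prems that by auto
  have "?M (concat (b # bs)) = four_block_mat (?M b) (0\<^sub>m (length b) (length (concat bs)))
      (0\<^sub>m (length (concat bs)) (length b)) (?M (concat bs))"
    by (rule eq_matI) (auto simp: nth_append z[OF nth_mem nth_mem] simp del: set_concat length_concat)
  also have "\<dots> = diag_block_mat (map ?M (b # bs))"
    by (simp add: D Let_def del: length_concat)
  finally show ?case .
qed

text \<open>Along a cycle listed backwards, \<open>f\<close> maps position \<open>r\<close> to \<open>r - 1\<close> and position \<open>0\<close> to \<open>N - 1\<close>. The
  weight of position \<open>0\<close>, whose label is \<open>f\<^sup>N x = x = f\<^sup>0 x\<close>, is therefore the value that the block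
  takes at \<open>i = N\<close>.\<close>

lemma orbit_block:
  assumes N: "(f ^^ N) x = x" and dist: "distinct (orbit_list f N x)"
    and B: "\<And>u v. u \<in> set (orbit_list f N x) \<Longrightarrow> v \<in> set (orbit_list f N x) \<Longrightarrow>
      B u v = (if v = f u then a u else 0)"
  shows "mat N N (\<lambda>(r, s). B (orbit_list f N x ! r) (orbit_list f N x ! s)) =
    cyclic_block N (\<lambda>i. a ((f ^^ (N - i)) x))"
proof (rule eq_matI)
  fix r s
  assume "r < dim_row (cyclic_block N (\<lambda>i. a ((f ^^ (N - i)) x)))"
    and "s < dim_col (cyclic_block N (\<lambda>i. a ((f ^^ (N - i)) x)))"
  then have r: "r < N" and s: "s < N"
    by (auto simp: cyclic_block_def)
  have "orbit_list f N x ! s = f (orbit_list f N x ! r) \<longleftrightarrow> s = (if r = 0 then N - 1 else r - 1)"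
    unfolding orbit_list_step[OF N r] using r s dist by (subst nth_eq_iff_index_eq) auto
  also have "\<dots> \<longleftrightarrow> r = s + 1 \<or> r = 0 \<and> s = N - 1"
    using r by auto
  finally have step: "orbit_list f N x ! s = f (orbit_list f N x ! r) \<longleftrightarrow>
      r = s + 1 \<or> r = 0 \<and> s = N - 1" .
  have "B (orbit_list f N x ! r) (orbit_list f N x ! s) =
      (if r = s + 1 \<or> r = 0 \<and> s = N - 1 then a (orbit_list f N x ! r) else 0)"
    using B[of "orbit_list f N x ! r" "orbit_list f N x ! s"] r s
    unfolding step by (metis length_orbit_list nth_mem)
  then show "mat N N (\<lambda>(r, s). B (orbit_list f N x ! r) (orbit_list f N x ! s)) $$ (r, s) =
      cyclic_block N (\<lambda>i. a ((f ^^ (N - i)) x)) $$ (r, s)"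
    using r s N by (auto simp: cyclic_block_def)
qed (auto simp: cyclic_block_def)

section \<open>Permutation matrices as products of transpositions\<close>

text \<open>The convention is that row \<open>i\<close> has its \<open>1\<close> in column \<open>p i\<close>, so that multiplication from the left
  moves row \<open>p i\<close> to position \<open>i\<close>. Products of such matrices then correspond to compositions in
  reverse order.\<close>

definition perm_matrix :: "nat \<Rightarrow> (nat \<Rightarrow> nat) \<Rightarrow> 'a::semiring_1 mat" where
  "perm_matrix n p = mat n n (\<lambda>(i, j). if j = p i then 1 else 0)"

lemma perm_matrix_carrier [simp]: "perm_matrix n p \<in> carrier_mat n n"
  by (simp add: perm_matrix_def)

lemma perm_matrix_mult_index:
  fixes M :: "'a::semiring_1 mat"
  assumes M: "M \<in> carrier_mat n n" and p: "p i < n" and ij: "i < n" "j < n"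
  shows "(perm_matrix n p * M) $$ (i, j) = M $$ (p i, j)"
proof -
  have "(perm_matrix n p * M) $$ (i, j) =
      (\<Sum>k\<in>{0..<n}. (if k = p i then 1 else 0) * M $$ (k, j))"
    using M ij by (simp add: scalar_prod_def perm_matrix_def)
  also have "\<dots> = (\<Sum>k\<in>{0..<n}. if k = p i then M $$ (p i, j) else 0)"
    by (rule sum.cong) auto
  finally show ?thesis
    using p by simp
qed

lemma mult_perm_matrix_inv_index:
  fixes M :: "'a::semiring_1 mat"
  assumes M: "M \<in> carrier_mat n n" and p: "p permutes {..<n}" and ij: "i < n" "j < n"
  shows "(M * perm_matrix n (Hilbert_Choice.inv p)) $$ (i, j) = M $$ (i, p j)"
proof -
  have pj: "p j < n"
    using permutes_in_image[OF p] ij by simp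
  have eq: "j = Hilbert_Choice.inv p k \<longleftrightarrow> k = p j" for k
    using permutes_inverses[OF p] by metis
  have "(M * perm_matrix n (Hilbert_Choice.inv p)) $$ (i, j) =
      (\<Sum>k\<in>{0..<n}. M $$ (i, k) * (if j = Hilbert_Choice.inv p k then 1 else 0))"
    using M ij by (simp add: scalar_prod_def perm_matrix_def)
  also have "\<dots> = (\<Sum>k\<in>{0..<n}. if k = p j then M $$ (i, p j) else 0)"
    by (rule sum.cong) (auto simp: eq)
  finally show ?thesis
    using pj by simp
qed

lemma perm_matrix_inverts:
  assumes p: "p permutes {..<n}"
  shows "inverts_mat (perm_matrix n p :: 'a::semiring_1 mat) (perm_matrix n (Hilbert_Choice.inv p))"
proof -
  have "perm_matrix n p * perm_matrix n (Hilbert_Choice.inv p) = (1\<^sub>m n :: 'a mat)"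
  proof (rule eq_matI)
    fix i j assume "i < dim_row (1\<^sub>m n :: 'a mat)" "j < dim_col (1\<^sub>m n :: 'a mat)"
    then have ij: "i < n" "j < n"
      by auto
    moreover have "p j < n" "p j = p i \<longleftrightarrow> i = j"
      using permutes_in_image[OF p] ij permutes_inj[OF p] by (auto dest: injD)
    ultimately show "(perm_matrix n p * perm_matrix n (Hilbert_Choice.inv p)) $$ (i, j) = (1\<^sub>m n :: 'a mat) $$ (i, j)"
      by (subst mult_perm_matrix_inv_index[OF _ p]) (auto simp: perm_matrix_def)
  qed (auto simp: perm_matrix_def)
  then show ?thesis
    by (simp add: inverts_mat_def perm_matrix_def)
qed

lemma elem_swap_mult_perm_matrix:
  assumes "i < n" "j < n"
  shows "elem_swap n i j * perm_matrix n p = perm_matrix n (p \<circ> Transposition.transpose i j)"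
proof -
  have "elem_swap n i j = swaprows_mat n i j"
    unfolding elem_swap_def by (rule eq_matI) (use assms in auto)
  then have "elem_swap n i j * perm_matrix n p = swaprows i j (perm_matrix n p)"
    using swaprows_mat[of "perm_matrix n p :: int mat" n n i j] assms by simp
  also have "\<dots> = perm_matrix n (p \<circ> Transposition.transpose i j)"
    by (rule eq_matI) (use assms in \<open>auto simp: perm_matrix_def Transposition.transpose_def\<close>)
  finally show ?thesis .
qed

text \<open>A factor on the left of the matrix product composes a transposition on the right of \<open>p\<close>; hence the
  reverse form of the induction over transpositions.\<close>

lemma perm_matrix_swap_prod:
  assumes "p permutes {..<n}"
  shows "\<exists>ijs. (\<forall>(i, j)\<in>set ijs. i < n \<and> j < n \<and> i \<noteq> j) \<and> perm_matrix n p = swap_prod n ijs"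
  using finite_lessThan assms
proof (induction rule: permutes_rev_induct)
  case id
  have "perm_matrix n (\<lambda>i. i) = (1\<^sub>m n :: int mat)"
    by (rule eq_matI) (auto simp: perm_matrix_def)
  then show ?case
    by (intro exI[of _ "[]"]) (simp add: swap_prod_def id_def)
next
  case (swap i j p)
  then obtain ijs where ijs: "\<forall>(i, j)\<in>set ijs. i < n \<and> j < n \<and> i \<noteq> j"
    "perm_matrix n p = swap_prod n ijs"
    by blast
  have "swap_prod n ((i, j) # ijs) = elem_swap n i j * perm_matrix n p"
    using ijs by (simp add: swap_prod_def)
  also have "\<dots> = perm_matrix n (p \<circ> Transposition.transpose i j)"
    by (rule elem_swap_mult_perm_matrix) (use swap in auto)
  finally show ?case
    using ijs swap.hyps by (intro exI[of _ "(i, j) # ijs"]) (auto simp: o_def)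
qed

lemma nth_permutes:
  assumes "distinct ys" and "set ys = {..<length ys}"
  shows "(\<lambda>i. if i < length ys then ys ! i else i) permutes {..<length ys}"
proof (rule bij_imp_permutes)
  have "bij_betw ((!) ys) {..<length ys} {..<length ys}"
    using assms by (intro bij_betw_nth) auto
  then show "bij_betw (\<lambda>i. if i < length ys then ys ! i else i) {..<length ys} {..<length ys}"
    by (rule bij_betw_cong[THEN iffD1, rotated]) simp
qed simp

section \<open>Non-negative integral roots of square-free scalar matrices\<close>

theorem theorem3p4:
  fixes d :: int and p :: "nat \<Rightarrow> int" and m N n :: nat and A :: "int mat"
  assumes "d \<ge> 2" and "squarefree d"
    and "d = (\<Prod>j=1..m. p j)"
    and "\<And>j. j \<in> {1..m} \<Longrightarrow> prime (p j)"
    and "inj_on p {1..m}"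
    and "N \<ge> 2"
    and "n \<ge> 1"
    and "A \<in> carrier_mat n n"
    and "\<And>i j. i < n \<Longrightarrow> j < n \<Longrightarrow> A $$ (i, j) \<ge> 0"
    and "A ^\<^sub>m N = d \<cdot>\<^sub>m 1\<^sub>m n"
  shows "\<exists>t\<ge>1. n = t * N \<and>
    (\<exists>ijs P Pinv. \<exists>c :: nat \<Rightarrow> nat \<Rightarrow> int.
       (\<forall>(i, j)\<in>set ijs. i < n \<and> j < n \<and> i \<noteq> j) \<and>
       P = swap_prod n ijs \<and>
       Pinv \<in> carrier_mat n n \<and> inverts_mat P Pinv \<and> inverts_mat Pinv P \<and>
       P * A * Pinv = diag_block_mat (map (\<lambda>k. cyclic_block N (\<lambda>i. c i k)) [1..<t+1]) \<and>
       (\<forall>k\<in>{1..t}. (\<forall>i\<in>{1..N}. c i k > 0) \<and> (\<Prod>i=1..N. c i k) = d))"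
proof -
  note d = assms(1) and sf = assms(2) and A = assms(8) and A0 = assms(9) and AN = assms(10)
  define B where "B = A ^\<^sub>m (N - 1)"
  have B: "B \<in> carrier_mat n n"
    using A by (simp add: B_def)
  have BA: "B * A = d \<cdot>\<^sub>m 1\<^sub>m n"
    using AN \<open>N \<ge> 2\<close> by (cases N) (auto simp: B_def)
  moreover have "A * B = B * A"
    unfolding B_def by (rule pow_mat_comm[OF A])
  ultimately have AB: "A * B = d \<cdot>\<^sub>m 1\<^sub>m n"
    by simp
  have B0: "B $$ (i, j) \<ge> 0" if "i < n" "j < n" for i j
    unfolding B_def by (rule pow_mat_nonneg[OF A A0 that])
  have "\<exists>j<n. A $$ (i, j) > 0 \<and> (\<forall>k<n. k \<noteq> j \<longrightarrow> A $$ (i, k) = 0)" if "i < n" for i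
    by (rule nonneg_factor_of_scalar_row[OF A B A0 B0 AB BA _ that]) (use d in auto)
  then obtain f where f: "\<And>i. i < n \<Longrightarrow> f i < n"
    and fpos: "\<And>i. i < n \<Longrightarrow> A $$ (i, f i) > 0"
    and fzero: "\<And>i k. i < n \<Longrightarrow> k < n \<Longrightarrow> k \<noteq> f i \<Longrightarrow> A $$ (i, k) = 0"
    by metis
  define a where "a i = A $$ (i, f i)" for i
  have Af: "A $$ (i, j) = (if j = f i then a i else 0)" if "i < n" "j < n" for i j
    using fzero that by (auto simp: a_def)
  have fpow: "(f ^^ k) i < n" if "i < n" for i k
    by (induction k) (use that f in auto)

  \<comment> \<open>As \<open>d \<noteq> 0\<close>, the walk of length \<open>N\<close> from \<open>i\<close> must end in the diagonal position.\<close>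
  have "(f ^^ N) i = i \<and> (\<Prod>l<N. a ((f ^^ l) i)) = d" if i: "i < n" for i
  proof -
    have "(A ^\<^sub>m N) $$ (i, i) = d"
      using AN i by simp
    then show ?thesis
      using monomial_pow_index[OF A f Af i i, of N] d by (auto split: if_splits)
  qed
  then have fN: "(f ^^ N) i = i" and prod: "(\<Prod>l<N. a ((f ^^ l) i)) = d" if "i < n" for i
    using that by auto
  have short: "(f ^^ k) i \<noteq> i" if "i < n" "0 < k" "k < N" for i k
    by (rule squarefree_walk_product_no_short_cycle[of a f i N])
      (use that fN prod sf d in auto)

  obtain xs where xs: "set xs \<subseteq> {..<n}" and dist: "distinct (concat (map (orbit_list f N) xs))"
    and set: "set (concat (map (orbit_list f N) xs)) = {..<n}"
    using orbit_listing[of "{..<n}" N f] \<open>N \<ge> 2\<close> f fN short by auto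
  define ys where "ys = concat (map (orbit_list f N) xs)"
  have len: "length ys = n"
    using distinct_card[OF dist] set by (simp add: ys_def)
  have nt: "n = length xs * N"
    using len by (simp add: ys_def length_concat o_def sum_list_triv)
  have orbit_lt: "u < n" if "x \<in> set xs" "u \<in> set (orbit_list f N x)" for x u
    using set that by auto
  have xs_lt: "x < n" if "x \<in> set xs" for x
    using xs that by auto

  define p where "p i = (if i < n then ys ! i else i)" for i
  have p: "p permutes {..<n}"
    using nth_permutes[of ys] dist set len by (simp add: p_def[abs_def] ys_def)
  obtain ijs where ijs: "\<forall>(i, j)\<in>set ijs. i < n \<and> j < n \<and> i \<noteq> j"
    and P: "perm_matrix n p = swap_prod n ijs"
    using perm_matrix_swap_prod[OF p] by blast
  have inv1: "inverts_mat (perm_matrix n p :: int mat) (perm_matrix n (Hilbert_Choice.inv p))"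
    by (rule perm_matrix_inverts[OF p])
  have inv2: "inverts_mat (perm_matrix n (Hilbert_Choice.inv p) :: int mat) (perm_matrix n p)"
    using perm_matrix_inverts[OF permutes_inv[OF p]] permutes_inv_inv[OF p] by simp

  have plt: "p i < n" if "i < n" for i
    using permutes_in_image[OF p] that by simp
  define C where "C u v = A $$ (u, v)" for u v
  have "perm_matrix n p * A * perm_matrix n (Hilbert_Choice.inv p) = mat n n (\<lambda>(i, j). C (ys ! i) (ys ! j))"
  proof (rule eq_matI)
    fix i j assume "i < dim_row (mat n n (\<lambda>(i, j). C (ys ! i) (ys ! j)))"
      "j < dim_col (mat n n (\<lambda>(i, j). C (ys ! i) (ys ! j)))"
    then have ij: "i < n" "j < n"
      by auto
    then have "(perm_matrix n p * A * perm_matrix n (Hilbert_Choice.inv p)) $$ (i, j) = A $$ (p i, p j)"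
      using A p plt by (subst mult_perm_matrix_inv_index[OF _ p])
        (auto simp: perm_matrix_mult_index intro!: mult_carrier_mat[of _ n n])
    then show "(perm_matrix n p * A * perm_matrix n (Hilbert_Choice.inv p)) $$ (i, j) =
        mat n n (\<lambda>(i, j). C (ys ! i) (ys ! j)) $$ (i, j)"
      using ij by (simp add: C_def p_def)
  qed (auto simp: perm_matrix_def)
  also have "\<dots> = diag_block_mat (map (\<lambda>b. mat (length b) (length b) (\<lambda>(i, j). C (b ! i) (b ! j)))
      (map (orbit_list f N) xs))"
  proof -
    \<comment> \<open>Distinct orbits are disjoint and closed under \<open>f\<close>, so no entry of \<open>A\<close> joins them.\<close>
    have C0: "C u v = 0" if "x \<in> set xs" "y \<in> set xs" "u \<in> set (orbit_list f N x)"
      "v \<in> set (orbit_list f N y)" "set (orbit_list f N x) \<inter> set (orbit_list f N y) = {}" for x y u v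
    proof -
      obtain k where "u = (f ^^ k) x"
        using \<open>u \<in> _\<close> by (rule orbit_list_elem)
      then have "f u \<in> set (orbit_list f N x)"
        using funpow_in_orbit_list[OF fN[OF xs_lt[OF that(1)]], of "Suc k"] \<open>N \<ge> 2\<close> by simp
      with that(4,5) have "v \<noteq> f u"
        by blast
      with orbit_lt that show ?thesis
        by (simp add: C_def Af)
    qed
    have "sorted_wrt (\<lambda>b c. \<forall>u\<in>set b. \<forall>v\<in>set c. C u v = 0 \<and> C v u = 0) (map (orbit_list f N) xs)"
      by (rule sorted_wrt_mono_rel[OF _ distinct_concat_disjoint[OF dist]])
        (use C0 in \<open>force simp: Int_commute\<close>)
    from mat_concat_blocks[OF this] show ?thesis
      unfolding ys_def[symmetric] len .
  qed
  also have "map (\<lambda>b. mat (length b) (length b) (\<lambda>(i, j). C (b ! i) (b ! j)))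
      (map (orbit_list f N) xs) = map (\<lambda>x. cyclic_block N (\<lambda>i. a ((f ^^ (N - i)) x))) xs"
  proof -
    have "mat N N (\<lambda>(i, j). C (orbit_list f N x ! i) (orbit_list f N x ! j)) =
        cyclic_block N (\<lambda>i. a ((f ^^ (N - i)) x))" if "x \<in> set xs" for x
      by (rule orbit_block)
        (use that xs_lt orbit_lt fN short Af in \<open>auto simp: C_def intro!: distinct_orbit_list\<close>)
    then show ?thesis
      by simp
  qed
  also have "\<dots> = map (\<lambda>k. cyclic_block N (\<lambda>i. a ((f ^^ (N - i)) (xs ! (k - 1))))) [1..<length xs + 1]"
    by (rule nth_equalityI) (auto simp del: upt_Suc)
  finally have form: "perm_matrix n p * A * perm_matrix n (Hilbert_Choice.inv p) = diag_block_mat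
      (map (\<lambda>k. cyclic_block N (\<lambda>i. a ((f ^^ (N - i)) (xs ! (k - 1))))) [1..<length xs + 1])" .

  have weights: "(\<forall>i\<in>{1..N}. a ((f ^^ (N - i)) x) > 0) \<and> (\<Prod>i=1..N. a ((f ^^ (N - i)) x)) = d"
    if "x \<in> set xs" for x
  proof -
    have "(\<Prod>i=1..N. a ((f ^^ (N - i)) x)) = (\<Prod>i<N. a ((f ^^ (N - Suc i)) x))"
      by (rule prod.reindex_bij_witness[of _ Suc "\<lambda>i. i - 1"]) auto
    also have "\<dots> = (\<Prod>l<N. a ((f ^^ l) x))"
      by (rule prod.nat_diff_reindex)
    finally show ?thesis
      using prod[OF xs_lt[OF that]] fpos fpow[OF xs_lt[OF that]] by (auto simp: a_def)
  qed

  show ?thesis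
  proof (rule exI[of _ "length xs"], intro conjI)
    show "length xs \<ge> 1"
      using nt \<open>n \<ge> 1\<close> by (cases xs) auto
    show "n = length xs * N"
      by (rule nt)
    have "\<forall>k\<in>{1..length xs}. (\<forall>i\<in>{1..N}. a ((f ^^ (N - i)) (xs ! (k - 1))) > 0) \<and>
        (\<Prod>i=1..N. a ((f ^^ (N - i)) (xs ! (k - 1)))) = d"
      by (intro ballI weights nth_mem) auto
    with ijs form[unfolded P] inv1[unfolded P] inv2[unfolded P]
    show "\<exists>ijs P Pinv. \<exists>c :: nat \<Rightarrow> nat \<Rightarrow> int.
       (\<forall>(i, j)\<in>set ijs. i < n \<and> j < n \<and> i \<noteq> j) \<and>
       P = swap_prod n ijs \<and>
       Pinv \<in> carrier_mat n n \<and> inverts_mat P Pinv \<and> inverts_mat Pinv P \<and>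
       P * A * Pinv = diag_block_mat (map (\<lambda>k. cyclic_block N (\<lambda>i. c i k)) [1..<length xs + 1]) \<and>
       (\<forall>k\<in>{1..length xs}. (\<forall>i\<in>{1..N}. c i k > 0) \<and> (\<Prod>i=1..N. c i k) = d)"
      by (intro exI[of _ ijs] exI[of _ "swap_prod n ijs"] exI[of _ "perm_matrix n (Hilbert_Choice.inv p)"]
        exI[of _ "\<lambda>i k. a ((f ^^ (N - i)) (xs ! (k - 1)))"] conjI) (rule perm_matrix_carrier | assumption | rule refl)+
  qed
qed

end
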